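(* Let $(\mathcal{P},\nabla)$ be a finite self-dual lattice, and let $\mathrm{Tr}(\mathcal{P})$ be the poset of transfer systems on $\mathcal{P}$ ordered by refinement. Then $\mathrm{Tr}(\mathcal{P})$ is self-dual, with duality $$\phi\colon \mathrm{Tr}(\mathcal{P})\to\mathrm{Tr}(\mathcal{P}),\qquad \phi(\mathcal{R})=\big(({}^{\square}\mathcal{R})^{\mathrm{op}}\big)^\nabla .$$ Moreover, if $\nabla$ is an involution, then so is $\phi$.
   Context: A poset $(\mathcal{P},\leq)$ is regarded as a category with a unique morphism $x\to y$ when $x\leq y$ and none otherwise; a relation refining $\leq$ is identified with the corresponding collection of morphisms. A poset $\mathcal{P}$ is self-dual if there is a bijection $\nabla\colon\mathcal{P}\to\mathcal{P}$, written $x\mapsto x^\nabla$, such that $x\leq y$ if and only if $y^\nabla\leq x^\nabla$; such a $\nabla$ is called a duality for $\mathcal{P}$ (it need not be an involution). One may view $\nabla$ as an isomorphism of categories $\mathcal{P}^{\mathrm{op}}\to\mathcal{P}$. For a collection $\mathcal{M}$ of morphisms of $\mathcal{P}$, $\mathcal{M}^{\mathrm{op}}$ is the corresponding collection of reversed morphisms in $\mathcal{P}^{\mathrm{op}}$, and $(\mathcal{M}^{\mathrm{op}})^\nabla$ is its image in $\mathcal{P}$ under $\nabla$; that is, $(\mathcal{M}^{\mathrm{op}})^\nabla=\{y^\nabla\to x^\nabla \mid (x\to y)\in\mathcal{M}\}$. A transfer system on $\mathcal{P}$ is a partial order $\mathcal{R}$ on (the underlying set of) $\mathcal{P}$ that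 refines $\leq$ (i.e. $x\,\mathcal{R}\,y$ implies $x\leq y$) and such that for all $x,y,z\in\mathcal{P}$, if $x\,\mathcal{R}\,y$, $z\leq y$, and $x\wedge z$ exists, then $(x\wedge z)\,\mathcal{R}\,z$. Refinement order on transfer systems is inclusion of relations. ${}^{\square}\mathcal{R}$ is the class of morphisms $i\colon a\to b$ of $\mathcal{P}$ having the left lifting property with respect to every $p\colon x\to y$ in $\mathcal{R}$: for every commutative square with $i$ on the left, $p$ on the right, top $a\to x$ and bottom $b\to y$, there is a morphism $b\to x$ making both triangles commute. *)

theory Defs
  imports Main
begin

text \<open>
  A poset is a type of class \<open>order\<close>, and the morphism \<open>x \<rightarrow> y\<close> of the associated category
  is the pair \<open>(x, y)\<close> with \<open>x \<le> y\<close>. A collection of morphisms is thus a relation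
  contained in \<open>\<le>\<close>.
\<close>

text \<open>
  Dualities are defined relative to a carrier \<open>A\<close>, so that the same notion applies to the lattice
  itself (\<open>A = UNIV\<close>) and to the set of transfer systems, where \<open>\<le>\<close> is inclusion of relations.
\<close>

definition duality_on :: "'a::order set \<Rightarrow> ('a \<Rightarrow> 'a) \<Rightarrow> bool" where
  "duality_on A f \<longleftrightarrow> bij_betw f A A \<and> (\<forall>x\<in>A. \<forall>y\<in>A. x \<le> y \<longleftrightarrow> f y \<le> f x)"

definition involution_on :: "'a set \<Rightarrow> ('a \<Rightarrow> 'a) \<Rightarrow> bool" where
  "involution_on A f \<longleftrightarrow> (\<forall>x\<in>A. f x \<in> A \<and> f (f x) = x)"

definition is_meet :: "'a::order \<Rightarrow> 'a \<Rightarrow> 'a \<Rightarrow> bool" where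
  "is_meet x z m \<longleftrightarrow> m \<le> x \<and> m \<le> z \<and> (\<forall>w. w \<le> x \<and> w \<le> z \<longrightarrow> w \<le> m)"

lemma is_meet_iff_inf: "is_meet x z m \<longleftrightarrow> m = inf x z" for x z m :: "'a::lattice"
  unfolding is_meet_def by (auto intro: order.antisym)

definition transfer_system :: "'a::order rel \<Rightarrow> bool" where
  "transfer_system R \<longleftrightarrow>
     partial_order_on UNIV R \<and>
     (\<forall>x y. (x, y) \<in> R \<longrightarrow> x \<le> y) \<and>
     (\<forall>x y z m. (x, y) \<in> R \<and> z \<le> y \<and> is_meet x z m \<longrightarrow> (m, z) \<in> R)"

definition Tr :: "'a::order rel set" where
  "Tr = {R. transfer_system R}"

text \<open>
  Since hom-sets of a poset have at most one element, a commutative square from \<open>a \<rightarrow> b\<close> to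
  \<open>x \<rightarrow> y\<close> amounts to \<open>a \<le> x\<close> and \<open>b \<le> y\<close>, and any morphism \<open>b \<rightarrow> x\<close> is a lift: both
  triangles commute automatically.
\<close>

definition has_lifting :: "'a::order \<times> 'a \<Rightarrow> 'a \<times> 'a \<Rightarrow> bool" where
  "has_lifting i p \<longleftrightarrow> (fst i \<le> fst p \<and> snd i \<le> snd p \<longrightarrow> snd i \<le> fst p)"

definition left_lifting_class :: "'a::order rel \<Rightarrow> 'a rel" where
  "left_lifting_class R = {i. fst i \<le> snd i \<and> (\<forall>p\<in>R. has_lifting i p)}"

definition transfer_dual :: "('a::order \<Rightarrow> 'a) \<Rightarrow> 'a rel \<Rightarrow> 'a rel" where
  "transfer_dual nabla R = map_prod nabla nabla ` ((left_lifting_class R)\<inverse>)"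

end

theory Submission
  imports Defs
begin

text \<open>
  In a finite lattice a transfer system \<open>R\<close> is the right class of a weak factorization system:
  for \<open>a \<le> b\<close>, the elements \<open>m\<close> with \<open>a \<le> m\<close> and \<open>(m, b) \<in> R\<close> are closed under meets, and the
  least of them factors \<open>a \<rightarrow> b\<close> as a map in the left lifting class followed by a map in \<open>R\<close>.
  By the retract argument \<open>R\<close> consists of the maps with the right lifting property against its
  left lifting class. So \<open>R \<mapsto> left_lifting_class R\<close> reverses and reflects inclusions;
  since there are finitely many transfer systems, the resulting injection is onto.
\<close>

definition right_lifting_class :: "'a::order rel \<Rightarrow> 'a rel" where
  "right_lifting_class S = {p. fst p \<le> snd p \<and> (\<forall>i\<in>S. has_lifting i p)}"

lemma mem_left_lifting_class_iff:
  "(a, b) \<in> left_lifting_class R \<longleftrightarrow>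
     a \<le> b \<and> (\<forall>x y. (x, y) \<in> R \<longrightarrow> a \<le> x \<longrightarrow> b \<le> y \<longrightarrow> b \<le> x)"
  unfolding left_lifting_class_def has_lifting_def by fastforce

lemma mem_right_lifting_class_iff:
  "(x, y) \<in> right_lifting_class S \<longleftrightarrow>
     x \<le> y \<and> (\<forall>a b. (a, b) \<in> S \<longrightarrow> a \<le> x \<longrightarrow> b \<le> y \<longrightarrow> b \<le> x)"
  unfolding right_lifting_class_def has_lifting_def by fastforce

lemma left_lifting_class_antimono: "R \<subseteq> R' \<Longrightarrow> left_lifting_class R' \<subseteq> left_lifting_class R"
  unfolding left_lifting_class_def by blast

lemma right_lifting_class_antimono: "S \<subseteq> S' \<Longrightarrow> right_lifting_class S' \<subseteq> right_lifting_class S"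
  unfolding right_lifting_class_def by blast

text \<open>Antisymmetry is inherited from \<le>, and in a lattice the only meet of \<open>x\<close>
  and \<open>z\<close> is \<open>inf x z\<close>, so closure under restriction becomes an equational
  condition.\<close>

lemma transfer_system_lattice_iff:
  "transfer_system R \<longleftrightarrow>
     (\<forall>x. (x, x) \<in> R) \<and> trans R \<and> (\<forall>x y. (x, y) \<in> R \<longrightarrow> x \<le> y) \<and>
     (\<forall>x y z. (x, y) \<in> R \<longrightarrow> z \<le> y \<longrightarrow> (inf x z, z) \<in> R)"
  for R :: "'a::lattice rel"
  unfolding transfer_system_def partial_order_on_def preorder_on_def is_meet_iff_inf
    refl_on_def antisym_def
  by (auto intro: order.antisym)

lemma transfer_system_factorization:
  fixes R :: "'a::{finite, lattice} rel"
  assumes "transfer_system R" "a \<le> b"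
  obtains m where "(a, m) \<in> left_lifting_class R" "(m, b) \<in> R"
proof -
  have refl: "(x, x) \<in> R" and trans: "(x, y) \<in> R \<Longrightarrow> (y, z) \<in> R \<Longrightarrow> (x, z) \<in> R"
    and inf: "(x, y) \<in> R \<Longrightarrow> z \<le> y \<Longrightarrow> (inf x z, z) \<in> R" for x y z
    using assms(1) unfolding transfer_system_lattice_iff by (auto dest: transD)
  define M where "M = {m. a \<le> m \<and> (m, b) \<in> R}"
  have "b \<in> M"
    using assms(2) refl by (simp add: M_def)
  then obtain m where m: "m \<in> M" and minimal: "\<And>n. n \<in> M \<Longrightarrow> n \<le> m \<Longrightarrow> m = n"
    using finite_has_minimal[of M] by (metis empty_iff finite_code)
  have "m \<le> x" if "(x, y) \<in> R" "a \<le> x" "m \<le> y" for x y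
  proof -
    \<comment> \<open>Restricting \<open>(x, y)\<close> along \<open>m \<le> y\<close> gives
      \<open>(inf x m, m) \<in> R\<close>, which composes with \<open>(m, b)\<close>; minimality
      then forces \<open>inf x m = m\<close>.\<close>
    have "inf x m \<in> M"
      using inf[OF that(1,3)] trans m that(2) by (auto simp: M_def)
    then show ?thesis
      using minimal[of "inf x m"] by (metis inf.cobounded1 inf.cobounded2)
  qed
  then have "(a, m) \<in> left_lifting_class R"
    using m by (auto simp: mem_left_lifting_class_iff M_def)
  with m that show thesis
    by (simp add: M_def)
qed

lemma right_left_lifting_class:
  fixes R :: "'a::{finite, lattice} rel"
  assumes "transfer_system R"
  shows "right_lifting_class (left_lifting_class R) = R"
proof
  show "R \<subseteq> right_lifting_class (left_lifting_class R)"
    using assms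
    by (auto simp: mem_right_lifting_class_iff mem_left_lifting_class_iff
        transfer_system_lattice_iff)
next
  show "right_lifting_class (left_lifting_class R) \<subseteq> R"
  proof (rule subrelI)
    fix a b
    assume ab: "(a, b) \<in> right_lifting_class (left_lifting_class R)"
    then obtain m where m: "(a, m) \<in> left_lifting_class R" "(m, b) \<in> R"
      using transfer_system_factorization[OF assms, of a b]
      by (auto simp: mem_right_lifting_class_iff)
    moreover from m(2) have "m \<le> b"
      using assms by (simp add: transfer_system_lattice_iff)
    \<comment> \<open>The retract argument: lifting \<open>(a, m)\<close> against
      \<open>(a, b)\<close> yields \<open>m \<le> a\<close>, so \<open>m = a\<close>.\<close>
    ultimately have "m \<le> a" "a \<le> m"
      using ab by (auto simp: mem_right_lifting_class_iff mem_left_lifting_class_iff)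
    then show "(a, b) \<in> R"
      using m(2) by (metis order.antisym)
  qed
qed

text \<open>For the forward direction, apply \<open>right_lifting_class\<close> to both sides, which
  recovers \<open>R\<close> and \<open>R'\<close>.\<close>

lemma left_lifting_class_subset_iff:
  fixes R R' :: "'a::{finite, lattice} rel"
  assumes "transfer_system R" "transfer_system R'"
  shows "left_lifting_class R' \<subseteq> left_lifting_class R \<longleftrightarrow> R \<subseteq> R'"
  using left_lifting_class_antimono right_lifting_class_antimono
    right_left_lifting_class[OF assms(1)] right_left_lifting_class[OF assms(2)]
  by metis

lemma duality_on_UNIV_iff:
  "duality_on UNIV f \<longleftrightarrow> bij f \<and> (\<forall>x y. f y \<le> f x \<longleftrightarrow> x \<le> y)"
  unfolding duality_on_def by auto

lemma transfer_dual_iff: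
  assumes "duality_on UNIV nabla"
  shows "(nabla y, nabla x) \<in> transfer_dual nabla R \<longleftrightarrow> (x, y) \<in> left_lifting_class R"
proof -
  have "inj (map_prod nabla nabla)"
    using assms by (simp add: duality_on_UNIV_iff bij_is_inj prod.inj_map)
  from inj_image_mem_iff[OF this, of "(y, x)"] show ?thesis
    by (simp add: transfer_dual_def)
qed

lemma transfer_dual_subset_iff:
  assumes "duality_on UNIV nabla"
  shows "transfer_dual nabla R \<subseteq> transfer_dual nabla R' \<longleftrightarrow>
    left_lifting_class R \<subseteq> left_lifting_class R'"
proof -
  have "inj (map_prod nabla nabla)"
    using assms by (simp add: duality_on_UNIV_iff bij_is_inj prod.inj_map)
  then show ?thesis
    unfolding transfer_dual_def by (simp add: inj_image_subset_iff)
qed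

text \<open>Every left lifting class contains identities and is closed under composition and
  pushout; the duality turns pushouts, which are joins, into the meets of the restriction
  axiom.\<close>

lemma transfer_system_transfer_dual:
  fixes R :: "'a::lattice rel"
  assumes dual: "duality_on UNIV nabla"
  shows "transfer_system (transfer_dual nabla R)"
proof -
  have le: "nabla y \<le> nabla x \<longleftrightarrow> x \<le> y" for x y
    using dual by (simp add: duality_on_UNIV_iff)
  note iff = transfer_dual_iff[OF dual] mem_left_lifting_class_iff
  have surj: "\<exists>x. a = nabla x" for a
    using dual by (metis duality_on_UNIV_iff bij_pointE)
  show ?thesis
    unfolding transfer_system_lattice_iff
  proof (intro conjI allI impI)
    fix a
    show "(a, a) \<in> transfer_dual nabla R"
      using surj[of a] by (auto simp: iff)
  next
    show "trans (transfer_dual nabla R)"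
    proof (rule transI)
      fix a b c
      assume "(a, b) \<in> transfer_dual nabla R" "(b, c) \<in> transfer_dual nabla R"
      moreover obtain x y z where "a = nabla x" "b = nabla y" "c = nabla z"
        using surj[of a] surj[of b] surj[of c] by blast
      ultimately show "(a, c) \<in> transfer_dual nabla R"
        by (simp add: iff) (meson order_trans)
    qed
  next
    fix a b
    assume "(a, b) \<in> transfer_dual nabla R"
    then show "a \<le> b"
      using surj[of a] surj[of b] by (auto simp: iff le)
  next
    fix a b c
    assume ab: "(a, b) \<in> transfer_dual nabla R" and "c \<le> b"
    obtain x y w u where eq: "a = nabla y" "b = nabla x" "c = nabla w" "inf a c = nabla u"
      using surj[of a] surj[of b] surj[of c] surj[of "inf a c"] by blast
    have xy: "(x, y) \<in> left_lifting_class R"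
      using ab by (simp add: eq transfer_dual_iff[OF dual])
    have "x \<le> w"
      using \<open>c \<le> b\<close> by (simp add: eq le)
    have "u \<le> v \<longleftrightarrow> y \<le> v \<and> w \<le> v" for v
      using eq le by (metis le_inf_iff)
    \<comment> \<open>So \<open>u\<close> is the join of \<open>y\<close> and \<open>w\<close>, and \<open>w \<rightarrow> u\<close> is the pushout of \<open>x \<rightarrow> y\<close>.\<close>
    then have "(w, u) \<in> left_lifting_class R"
      using xy \<open>x \<le> w\<close> unfolding mem_left_lifting_class_iff by (meson order_refl order_trans)
    then show "(inf a c, c) \<in> transfer_dual nabla R"
      unfolding eq(4) unfolding eq(3) transfer_dual_iff[OF dual] .
  qed
qed

text \<open>Reversing the order exchanges the two sides of a lifting problem:
  \<open>(nabla x, nabla y)\<close> lifts against \<open>(nabla b, nabla a)\<close> exactly when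
  \<open>(a, b)\<close> lifts against \<open>(y, x)\<close>.\<close>

lemma left_lifting_class_transfer_dual:
  assumes dual: "duality_on UNIV nabla"
  shows "(nabla x, nabla y) \<in> left_lifting_class (transfer_dual nabla R) \<longleftrightarrow>
    (y, x) \<in> right_lifting_class (left_lifting_class R)"
proof -
  have le: "nabla y \<le> nabla x \<longleftrightarrow> x \<le> y" for x y
    using dual by (simp add: duality_on_UNIV_iff)
  have surj: "\<exists>x. a = nabla x" for a
    using dual by (metis duality_on_UNIV_iff bij_pointE)
  \<comment> \<open>The swapped order of \<open>a\<close> and \<open>b\<close> matches the reversed
    pairs in \<open>transfer_dual_iff\<close>.\<close>
  have all_iff: "(\<forall>s t. P s t) \<longleftrightarrow> (\<forall>a b. P (nabla b) (nabla a))" for P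
  proof (intro iffI allI)
    fix s t
    assume "\<forall>a b. P (nabla b) (nabla a)"
    then show "P s t"
      using surj[of s] surj[of t] by auto
  qed simp
  show ?thesis
    unfolding mem_left_lifting_class_iff[of "nabla x"] mem_right_lifting_class_iff
    by (subst all_iff) (unfold le transfer_dual_iff[OF dual], blast)
qed

text \<open>Writing \<open>a\<close> and \<open>b\<close> as double images under
  \<open>nabla\<close> reduces the double dual to the right class of the left class of
  \<open>R\<close>, which is \<open>R\<close>.\<close>

lemma transfer_dual_transfer_dual:
  fixes R :: "'a::{finite, lattice} rel"
  assumes dual: "duality_on UNIV nabla" and invol: "\<And>x. nabla (nabla x) = x"
    and "transfer_system R"
  shows "transfer_dual nabla (transfer_dual nabla R) = R"
proof -
  have "(a, b) \<in> transfer_dual nabla (transfer_dual nabla R) \<longleftrightarrow> (a, b) \<in> R" for a b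
    using transfer_dual_iff[OF dual, of "nabla a" "nabla b"]
      left_lifting_class_transfer_dual[OF dual, of b a R]
    by (simp add: invol right_left_lifting_class[OF assms(3)])
  then show ?thesis
    by auto
qed

theorem theorem4p21:
  fixes nabla :: "'a::{finite, lattice} \<Rightarrow> 'a"
  assumes "duality_on UNIV nabla"
  shows "duality_on Tr (transfer_dual nabla) \<and>
    (involution_on UNIV nabla \<longrightarrow> involution_on Tr (transfer_dual nabla))"
proof (intro conjI impI)
  have maps: "transfer_dual nabla ` Tr \<subseteq> Tr"
    using transfer_system_transfer_dual[OF assms] by (auto simp: Tr_def)
  have rev: "transfer_dual nabla R' \<subseteq> transfer_dual nabla R \<longleftrightarrow> R \<subseteq> R'"
    if "R \<in> Tr" "R' \<in> Tr" for R R'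
    using that transfer_dual_subset_iff[OF assms] left_lifting_class_subset_iff
    by (simp add: Tr_def)
  \<comment> \<open>Equal images include each other, so reflecting inclusions in both directions
    gives equality.\<close>
  then have "inj_on (transfer_dual nabla) Tr"
    by (metis inj_onI order_refl subset_antisym)
  then have "bij_betw (transfer_dual nabla) Tr Tr"
    using maps by (simp add: bij_betw_def endo_inj_surj)
  then show "duality_on Tr (transfer_dual nabla)"
    using rev by (simp add: duality_on_def)
next
  assume "involution_on UNIV nabla"
  then show "involution_on Tr (transfer_dual nabla)"
    using transfer_system_transfer_dual[OF assms] transfer_dual_transfer_dual[OF assms]
    by (simp add: involution_on_def Tr_def)
qed

end
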